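(* Let $q\ge 2$ be an integer, let $T$ be a $(q+1)$-homogeneous tree rooted at $o$, let $\phi:T\to T$ be a self map and let $1\le p<\infty$. If $$\sup_{n\in\mathbb{N}}\left(\sum_{|v|=n}q^{|\phi(v)|-n}\right)<\infty,$$ then $C_\phi$ is bounded on $\mathbb{T}_p$.
   Context: $\mathbb{N}=\{1,2,\ldots\}$, $\mathbb{N}_0=\mathbb{N}\cup\{0\}$. A $(q+1)$-homogeneous tree is an (infinite) connected graph without cycles in which every vertex has exactly $q+1$ neighbours; it is rooted at a fixed vertex $o$. We identify $T$ with its vertex set, and $|v|$ denotes the number of edges in the unique path from $o$ to $v$. A self map of $T$ is an arbitrary function $\phi:T\to T$ on vertices. For $f:T\to\mathbb{C}$ put $M_p(0,f)=|f(o)|$ and, for $n\in\mathbb{N}$, $M_p(n,f)=\left(\frac{1}{(q+1)q^{n-1}}\sum_{|v|=n}|f(v)|^p\right)^{1/p}$. Let $\|f\|_p=\sup_{n\in\mathbb{N}_0}M_p(n,f)$ and $\mathbb{T}_p=\{f:T\to\mathbb{C} : \|f\|_p<\infty\}$. The composition operator is $C_\phi f=f\circ\phi$. Its operator norm is $\|C_\phi\|=\sup\{\|f\circ\phi\|_p : \|f\|_p=1\}$, and $C_\phi$ is bounded on $\mathbb{T}_p$ if it maps $\mathbb{T}_p$ into itself and $\|C_\phi\|<\infty$. *)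

theory Defs
  imports
    "HOL-Library.Extended_Nonnegative_Real"
    "HOL-Library.FuncSet"
    "Graph_Theory.Graph_Theory"
begin

text \<open>
  An undirected simple graph is a symmetric loop-free pair digraph, possibly infinite: every
  undirected edge is a pair of opposite arcs. Such a pair is itself a directed cycle of length 2,
  so the predicate \<^const>\<open>Digraph_Component.tree\<close> is unusable here; undirected cycles are the
  directed cycles of length at least 3.
\<close>

locale homogeneous_tree = pair_bidirected_digraph G
  for G :: "'a pair_pre_digraph" +
  fixes q :: nat and rt :: 'a
  assumes connected_graph: "Digraph_Component.connected G"
    and no_undirected_cycle: "\<not> (\<exists>p. cycle p \<and> 3 \<le> length p)"
    and degree: "\<And>v. v \<in> pverts G \<Longrightarrow> out_degree G v = q + 1"
    and root_in_verts: "rt \<in> pverts G"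
begin

text \<open>An \<^const>\<open>apath\<close> is a list of arcs, so its length counts edges.\<close>

definition height :: "'a \<Rightarrow> nat" where
  "height v = length (THE p. apath rt p v)"

definition sphere :: "nat \<Rightarrow> 'a set" where
  "sphere n = {v \<in> pverts G. height v = n}"

text \<open>
  Functions on the tree are total functions on the type \<^typ>\<open>'a\<close>; only their values on
  \<^term>\<open>pverts G\<close> enter below.
\<close>

definition M :: "real \<Rightarrow> nat \<Rightarrow> ('a \<Rightarrow> complex) \<Rightarrow> real" where
  "M p n f =
     (if n = 0 then cmod (f rt)
      else (1 / ((real q + 1) * real q ^ (n - 1)) * (\<Sum>v\<in>sphere n. cmod (f v) powr p)) powr (1 / p))"

definition T_norm :: "real \<Rightarrow> ('a \<Rightarrow> complex) \<Rightarrow> ennreal" where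
  "T_norm p f = (SUP n. ennreal (M p n f))"

definition T_space :: "real \<Rightarrow> ('a \<Rightarrow> complex) set" where
  "T_space p = {f. T_norm p f < \<infinity>}"

definition op_norm :: "real \<Rightarrow> (('a \<Rightarrow> complex) \<Rightarrow> ('a \<Rightarrow> complex)) \<Rightarrow> ennreal" where
  "op_norm p A = (SUP f\<in>{f. T_norm p f = 1}. T_norm p (A f))"

definition bounded_on_T :: "real \<Rightarrow> (('a \<Rightarrow> complex) \<Rightarrow> ('a \<Rightarrow> complex)) \<Rightarrow> bool" where
  "bounded_on_T p A \<longleftrightarrow> A ` T_space p \<subseteq> T_space p \<and> op_norm p A < \<infinity>"

end

definition composition_operator :: "('a \<Rightarrow> 'a) \<Rightarrow> ('a \<Rightarrow> complex) \<Rightarrow> ('a \<Rightarrow> complex)" where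
  "composition_operator \<phi> f = f \<circ> \<phi>"

end

theory Submission
  imports Defs
begin

text \<open>
  A single value of \<open>f\<close> on the sphere of radius \<open>m\<close> is controlled by the mean over that sphere, so
  \<open>\<bar>f w\<bar>\<^sup>p \<le> (q + 1) q\<^sup>m\<^sup>-\<^sup>1 \<parallel>f\<parallel>\<^sup>p \<le> 2 q\<^sup>m \<parallel>f\<parallel>\<^sup>p\<close>. Applying this at \<open>w = \<phi> v\<close>
  and averaging over the sphere of radius \<open>n\<close> bounds \<open>M p n (f \<circ> \<phi>)\<^sup>p\<close> by twice the \<open>n\<close>-th sum of
  the hypothesis, times \<open>\<parallel>f\<parallel>\<^sup>p\<close>. The first step needs finite spheres, hence paths from the root
  must be unique for the height to be the length of an actual path.
\<close>

text \<open>Go along the first path from \<open>u\<close> through \<open>x\<close> to its first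
  meeting point \<open>z\<close> with the second path, then back along the second path through
  \<open>y\<close> to \<open>u\<close>.\<close>

lemma (in pair_sym_digraph) diverging_apaths_imp_cycle:
  assumes p: "apath u ((u, x) # p) v" and r: "apath u ((u, y) # r) v" and "x \<noteq> y"
  shows "\<exists>c. cycle c \<and> 3 \<le> length c"
proof -
  let ?X = "awalk_verts x p" and ?Y = "awalk_verts y r"
  have p': "awalk x p v" "distinct ?X" "u \<notin> set ?X" "(u, x) \<in> parcs G"
    using p by (auto simp: apath_def awalk_Cons_iff)
  have r': "awalk y r v" "distinct ?Y" "u \<notin> set ?Y" "(u, y) \<in> parcs G"
    using r by (auto simp: apath_def awalk_Cons_iff)
  have "v \<in> set ?X" "v \<in> set ?Y"
    using p'(1) r'(1) awlast_of_awalk last_in_set awalk_verts_non_Nil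
    by (metis awalkE')+
  then have "\<exists>z\<in>set ?X. z \<in> set ?Y" by blast
  \<comment> \<open>Taking the first common vertex makes \<open>X1\<close> disjoint from
    \<open>?Y\<close>, so the closed walk built below repeats no vertex except its endpoint.\<close>
  then obtain X1 z X2 where X: "?X = X1 @ z # X2" "z \<in> set ?Y" "\<forall>w\<in>set X1. w \<notin> set ?Y"
    by (rule split_list_first_propE)
  from X(2) obtain Y1 Y2 where Y: "?Y = Y1 @ z # Y2"
    by (meson split_list)
  have "cas x p v" "cas y r v" using p'(1) r'(1) by auto
  obtain p1 p2 where p1: "cas x p1 z" "p = p1 @ p2" "awalk_verts x p1 = X1 @ [z]"
    using awalk_decomp_verts[OF \<open>cas x p v\<close> X(1)] by metis
  obtain r1 r2 where r1: "cas y r1 z" "r = r1 @ r2" "awalk_verts y r1 = Y1 @ [z]"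
    using awalk_decomp_verts[OF \<open>cas y r v\<close> Y] by metis
  have w: "awalk x p1 z" "awalk y r1 z"
    using p1 r1 p'(1) r'(1) by (auto simp: awalk_def)
  define c where "c = (u, x) # p1 @ rev_path r1 @ [(y, u)]"
  have w2: "awalk z (rev_path r1) y" using w by simp
  have w3: "awalk y [(y, u)] u"
    using r'(4) by (auto simp: awalk_simps intro: arcs_symmetric in_arcsD1)
  have w4: "awalk z (rev_path r1 @ [(y, u)]) u"
    using awalk_appendI[OF w2 w3] .
  have w5: "awalk x (p1 @ rev_path r1 @ [(y, u)]) u"
    using awalk_appendI[OF w(1) w4] .
  have "awalk_verts z (rev_path r1 @ [(y, u)]) = z # rev Y1 @ [u]"
    using awalk_verts_append[OF w4] w2 by (simp add: awalk_verts_rev_path[OF w(2)] r1(3))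
  then have verts: "tl (awalk_verts u c) = X1 @ z # rev Y1 @ [u]"
    using awalk_verts_append[OF w5] w(1) by (simp add: c_def p1(3))
  have "awalk u c u"
    using w5 p'(4) by (auto simp: c_def awalk_Cons_iff)
  moreover have "distinct (tl (awalk_verts u c))"
    unfolding verts using p'(2,3) r'(2,3) X Y by auto
  ultimately have "cycle c" by (auto simp: cycle_def c_def)
  \<comment> \<open>If both pieces were empty, then \<open>x = z = y\<close>. So \<open>c\<close> is
    not the trivial 2-cycle that every undirected edge yields.\<close>
  moreover have "p1 \<noteq> [] \<or> r1 \<noteq> []"
    using p1(1) r1(1) \<open>x \<noteq> y\<close> by auto
  then have "3 \<le> length c"
  proof
    assume "p1 \<noteq> []" then show ?thesis by (cases p1) (auto simp: c_def)
  next
    assume "r1 \<noteq> []" then show ?thesis by (cases r1) (auto simp: c_def)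
  qed
  ultimately show ?thesis by blast
qed

context homogeneous_tree
begin

text \<open>Two paths with common ends must share their first arc, since otherwise they would close
  up to a forbidden cycle; induction then strips that arc.\<close>

lemma apath_unique:
  assumes "apath u p v" "apath u r v"
  shows "p = r"
  using assms
proof (induction p arbitrary: u r)
  case Nil
  then show ?case using apath_ends apath_Nil_iff by metis
next
  case (Cons e p)
  have "r \<noteq> []" using Cons.prems apath_ends apath_Nil_iff by (metis list.distinct(1))
  then obtain d r' where r: "r = d # r'" by (cases r) auto
  obtain x y where e: "e = (u, x)" and d: "d = (u, y)"
    using Cons.prems r by (cases e; cases d) (auto simp: apath_Cons_iff)
  have "x = y"
    using diverging_apaths_imp_cycle Cons.prems no_undirected_cycle unfolding r e d by metis
  then show ?case
    using Cons.IH[of x r'] Cons.prems unfolding r e d by (auto simp: apath_Cons_iff)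
qed

text \<open>Uniqueness turns the description in \<open>height\<close> into an actual path. One
  exists because a connected symmetric digraph is strongly connected.\<close>

lemma apath_height:
  assumes "v \<in> pverts G"
  obtains p where "apath rt p v" "length p = height v"
proof -
  have "strongly_connected G"
    using symmetric_connected_imp_strongly_connected[OF sym_arcs connected_graph] .
  then have "rt \<rightarrow>\<^sup>*\<^bsub>G\<^esub> v"
    using assms root_in_verts by (auto simp: strongly_connected_def)
  then obtain p where p: "apath rt p v" using reachable_apath by blast
  then have "(THE p. apath rt p v) = p" using apath_unique by blast
  with p that show ?thesis by (auto simp: height_def)
qed

lemma height_eq_0:
  assumes "v \<in> pverts G" "height v = 0"
  shows "v = rt"
  using apath_height[OF assms(1)] assms(2) by (auto simp: apath_Nil_iff)

text \<open>By induction, the ends of walks of length \<open>Suc n\<close> are heads of arcs leaving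
  the finitely many ends of walks of length \<open>n\<close>.\<close>

lemma finite_awalk_ends: "finite {v. \<exists>p. awalk u p v \<and> length p = n}"
proof (induction n)
  case 0
  have "{v. \<exists>p. awalk u p v \<and> length p = 0} \<subseteq> {u}" by (auto simp: awalk_Nil_iff)
  then show ?case by (rule finite_subset) simp
next
  case (Suc n)
  \<comment> \<open>Infinite sets have \<open>card\<close> 0, so the positive out-degree
    \<open>q + 1\<close> forces finiteness.\<close>
  have fin: "finite (out_arcs G v)" if "v \<in> pverts G" for v
    using degree[OF that] by (intro card_ge_0_finite) (simp add: out_degree_def)
  let ?S = "{v. \<exists>p. awalk u p v \<and> length p = n}"
  have "{v. \<exists>p. awalk u p v \<and> length p = Suc n} \<subseteq> (\<Union>v\<in>?S. snd ` out_arcs G v)"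
  proof clarify
    fix w p assume p: "awalk u p w" "length p = Suc n"
    then obtain p' e where pe: "p = p' @ [e]" by (metis length_Suc_conv_rev)
    let ?v = "awlast u p'"
    have "awalk u p' ?v" "awalk ?v [e] w" using p(1) unfolding pe by auto
    then show "w \<in> (\<Union>v\<in>?S. snd ` out_arcs G v)"
      using p(2) pe by (intro UN_I[of ?v]) (auto simp: awalk_simps out_arcs_def)
  qed
  moreover have "?S \<subseteq> pverts G" using awalk_last_in_verts by blast
  ultimately show ?case
    using Suc.IH fin by (meson finite_UN_I finite_imageI finite_subset subsetD)
qed

lemma finite_sphere: "finite (sphere n)"
proof (rule finite_subset[OF _ finite_awalk_ends])
  show "sphere n \<subseteq> {v. \<exists>p. awalk rt p v \<and> length p = n}"
  proof
    fix v assume "v \<in> sphere n"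
    then obtain p where "apath rt p v" "length p = n"
      by (auto simp: sphere_def elim: apath_height)
    then show "v \<in> {v. \<exists>p. awalk rt p v \<and> length p = n}"
      using awalkI_apath by blast
  qed
qed

lemma T_norm_le_iff:
  assumes "0 \<le> N"
  shows "T_norm p f \<le> ennreal N \<longleftrightarrow> (\<forall>n. M p n f \<le> N)"
  using assms by (simp add: T_norm_def SUP_le_iff ennreal_le_iff)

lemma pointwise_bound:
  assumes "0 < q" "1 \<le> p" "w \<in> pverts G" and M: "\<And>n. M p n f \<le> N"
  shows "cmod (f w) powr p \<le> 2 * real q ^ height w * N powr p"
proof (cases "height w")
  case 0
  then have "cmod (f w) \<le> N"
    using M[of 0] height_eq_0 assms(3) by (auto simp: M_def)
  then have "cmod (f w) powr p \<le> N powr p" using assms by (intro powr_mono2) auto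
  then show ?thesis using 0 by (simp add: order_trans[of _ "N powr p"])
next
  case (Suc m)
  define D where "D = (real q + 1) * real q ^ m"
  have "0 < D" using assms(1) by (simp add: D_def add_pos_nonneg)
  define A where "A = 1 / D * (\<Sum>v\<in>sphere (Suc m). cmod (f v) powr p)"
  have "0 \<le> A" using \<open>0 < D\<close> by (simp add: A_def sum_nonneg)
  have "A powr (1 / p) \<le> N" using M[of "Suc m"] by (simp add: M_def A_def D_def)
  then have "(A powr (1 / p)) powr p \<le> N powr p" using assms by (intro powr_mono2) auto
  then have A: "A \<le> N powr p" using \<open>0 \<le> A\<close> assms(2) by (simp add: powr_powr)
  \<comment> \<open>Finiteness of the sphere matters here: a sum over an infinite set would be 0 by
    convention.\<close>
  have "cmod (f w) powr p \<le> (\<Sum>v\<in>sphere (Suc m). cmod (f v) powr p)"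
    using assms(3) Suc finite_sphere by (intro member_le_sum) (auto simp: sphere_def)
  also have "\<dots> = D * A" using \<open>0 < D\<close> by (simp add: A_def)
  also have "\<dots> \<le> D * N powr p" using A \<open>0 < D\<close> by simp
  \<comment> \<open>The constant 2 comes from \<open>q + 1 \<le> 2 * q\<close>.\<close>
  also have "\<dots> \<le> (2 * real q ^ height w) * N powr p"
    using assms(1) Suc by (intro mult_right_mono) (simp_all add: D_def)
  finally show ?thesis .
qed

text \<open>The bound \<open>C0\<close> serves the mean at \<open>n = 0\<close>, which the sums in
  \<open>C\<close> do not cover.\<close>

lemma M_composition_le:
  assumes "0 < q" "1 \<le> p" "\<phi> \<in> pverts G \<rightarrow> pverts G" "0 \<le> N" "\<And>n. M p n f \<le> N"
    and C0: "real q ^ height (\<phi> rt) \<le> C"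
    and C: "\<And>n. 1 \<le> n \<Longrightarrow> (\<Sum>v\<in>sphere n. real q powi (int (height (\<phi> v)) - int n)) \<le> C"
  shows "M p n (composition_operator \<phi> f) \<le> (2 * C) powr (1 / p) * N"
proof -
  have "0 \<le> C" using C0 by (meson order_trans of_nat_0_le_iff zero_le_power)
  have root: "a powr (1 / p) \<le> (2 * C) powr (1 / p) * N"
    if "0 \<le> a" "a \<le> 2 * C * N powr p" for a
  proof -
    have "a powr (1 / p) \<le> (2 * C * N powr p) powr (1 / p)"
      using that assms(2) by (intro powr_mono2) auto
    also have "\<dots> = (2 * C) powr (1 / p) * N"
      using \<open>0 \<le> C\<close> assms(2,4) by (simp add: powr_mult powr_powr)
    finally show ?thesis .
  qed
  have bound: "cmod (f (\<phi> v)) powr p \<le> 2 * real q ^ height (\<phi> v) * N powr p"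
    if "v \<in> pverts G" for v
    using that assms by (intro pointwise_bound) auto
  show ?thesis
  proof (cases "n = 0")
    case True
    have "cmod (f (\<phi> rt)) powr p \<le> 2 * real q ^ height (\<phi> rt) * N powr p"
      using bound root_in_verts .
    also have "\<dots> \<le> 2 * C * N powr p"
      using C0 by (intro mult_right_mono) auto
    finally have "(cmod (f (\<phi> rt)) powr p) powr (1 / p) \<le> (2 * C) powr (1 / p) * N"
      by (intro root) auto
    then show ?thesis using True assms(2) by (simp add: M_def composition_operator_def powr_powr)
  next
    case False
    define D where "D = (real q + 1) * real q ^ (n - 1)"
    \<comment> \<open>Writing \<open>q ^ height (\<phi> v)\<close> as \<open>q ^ n\<close> times the
      weight in \<open>C\<close> leaves a factor \<open>q ^ n\<close>, which the normalising
      constant \<open>D\<close> absorbs.\<close>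
    have D: "real q ^ n \<le> D" "0 < D"
      using False assms(1) by (cases n; simp add: D_def add_pos_nonneg)+
    have "(\<Sum>v\<in>sphere n. cmod (f (\<phi> v)) powr p)
        \<le> (\<Sum>v\<in>sphere n. real q ^ n * 2 * N powr p * (real q powi (int (height (\<phi> v)) - int n)))"
    proof (rule sum_mono)
      fix v assume "v \<in> sphere n"
      then have "v \<in> pverts G" by (simp add: sphere_def)
      from bound[OF this]
      show "cmod (f (\<phi> v)) powr p
          \<le> real q ^ n * 2 * N powr p * (real q powi (int (height (\<phi> v)) - int n))"
        using assms(1) by (simp add: power_int_diff mult_ac)
    qed
    also have "\<dots> \<le> real q ^ n * 2 * N powr p * C"
      unfolding sum_distrib_left[symmetric] using C[of n] False by (intro mult_left_mono) auto
    also have "\<dots> \<le> D * (2 * C * N powr p)"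
      using mult_right_mono[OF D(1), of "2 * C * N powr p"] \<open>0 \<le> C\<close> by (simp add: mult_ac)
    finally have "1 / D * (\<Sum>v\<in>sphere n. cmod (f (\<phi> v)) powr p) \<le> 2 * C * N powr p"
      using D by (simp add: divide_le_eq mult_ac)
    then have "(1 / D * (\<Sum>v\<in>sphere n. cmod (f (\<phi> v)) powr p)) powr (1 / p)
        \<le> (2 * C) powr (1 / p) * N"
      using D by (intro root) (auto intro!: divide_nonneg_nonneg sum_nonneg)
    then show ?thesis using False by (simp add: M_def D_def composition_operator_def)
  qed
qed

text \<open>Taking \<open>N\<close> to be the norm of \<open>f\<close> gives invariance of the
  space; \<open>N = 1\<close> gives \<open>op_norm p A \<le> K\<close>.\<close>

lemma bounded_on_T_if_T_norm_le:
  assumes "0 \<le> K"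
    and le: "\<And>f N. 0 \<le> N \<Longrightarrow> T_norm p f \<le> ennreal N \<Longrightarrow> T_norm p (A f) \<le> ennreal (K * N)"
  shows "bounded_on_T p A"
  unfolding bounded_on_T_def
proof
  show "A ` T_space p \<subseteq> T_space p"
  proof clarify
    fix f assume "f \<in> T_space p"
    then obtain N where "0 \<le> N" "T_norm p f = ennreal N"
      by (cases "T_norm p f") (auto simp: T_space_def)
    then have "T_norm p (A f) \<le> ennreal (K * N)" using le by simp
    then show "A f \<in> T_space p"
      by (auto simp: T_space_def intro: order.strict_trans1)
  qed
  have "op_norm p A \<le> ennreal K"
    unfolding op_norm_def using le[of 1] by (auto intro!: SUP_least)
  then show "op_norm p A < \<infinity>"
    by (auto intro: order.strict_trans1)
qed

end

theorem theorem3: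
  fixes G :: "'a pair_pre_digraph" and q :: nat and rt :: 'a
    and \<phi> :: "'a \<Rightarrow> 'a" and p :: real
  assumes "q \<ge> 2"
    and "homogeneous_tree G q rt"
    and "\<phi> \<in> pverts G \<rightarrow> pverts G"
    and "1 \<le> p"
    and "(SUP n\<in>{1::nat..}. ennreal (\<Sum>v\<in>homogeneous_tree.sphere G rt n.
            real q powi (int (homogeneous_tree.height G rt (\<phi> v)) - int n))) < \<infinity>"
  shows "homogeneous_tree.bounded_on_T G q rt p (composition_operator \<phi>)"
proof -
  interpret homogeneous_tree G q rt by fact
  let ?s = "\<lambda>n. \<Sum>v\<in>sphere n. real q powi (int (height (\<phi> v)) - int n)"
  obtain S where S: "0 \<le> S" "(SUP n\<in>{1::nat..}. ennreal (?s n)) = ennreal S"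
    using assms(5) less_top_ennreal by (auto simp del: SUP_eq_top_iff)
  have s: "?s n \<le> S" if "1 \<le> n" for n
  proof -
    have "ennreal (?s n) \<le> ennreal S"
      unfolding S(2)[symmetric] using that by (intro SUP_upper) simp
    then show ?thesis using S(1) by (simp add: ennreal_le_iff)
  qed
  \<comment> \<open>The second summand handles the root, as the supremum \<open>S\<close> starts at
    \<open>n = 1\<close>.\<close>
  define C where "C = S + real q ^ height (\<phi> rt)"
  show ?thesis
  proof (rule bounded_on_T_if_T_norm_le)
    fix f N assume N: "0 \<le> (N::real)" "T_norm p f \<le> ennreal N"
    have "M p n (composition_operator \<phi> f) \<le> (2 * C) powr (1 / p) * N" for n
    proof (rule M_composition_le)
      show "M p n f \<le> N" for n using N T_norm_le_iff by blast
      show "?s n \<le> C" if "1 \<le> n" for n using s[OF that] by (simp add: C_def add_increasing2)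
    qed (use assms N S in \<open>auto simp: C_def\<close>)
    then show "T_norm p (composition_operator \<phi> f) \<le> ennreal ((2 * C) powr (1 / p) * N)"
      using N(1) by (subst T_norm_le_iff) auto
  qed simp
qed

end
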